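(* Let $\Gamma$ be a MOY graph and let $N$ be a positive integer. Let $w=(w_e)_{e\in E(\Gamma)}$ be commuting variables, let $$F^{\mathrm{class}}_{\Gamma,N}(w)=\sum_{\gamma}\langle\Gamma,\gamma\rangle_N(1)\,w^\gamma,\qquad w^\gamma=\prod_{e\in E(\Gamma)}w_e^{\gamma(e)},$$ where the sum runs over all colorings $\gamma$ of $\Gamma$ and $\langle\Gamma,\gamma\rangle_N(1)$ is the MOY evaluation at $q=1$, and let $$P^{\mathrm{class}}_\Gamma(w)=\sum_{C\in\mathcal C(\Gamma)}w^C,\qquad w^C=\prod_{e\in C}w_e,$$ be the classical cycle polynomial, where $\mathcal C(\Gamma)$ is the set of cycles of $\Gamma$ (including the empty cycle). Then $$F^{\mathrm{class}}_{\Gamma,N}(w)=\left(P^{\mathrm{class}}_\Gamma(w)\right)^N .$$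
   Context: **MOY graphs and colorings.** A MOY graph $\Gamma$ is a finite trivalent graph embedded in the plane, with oriented edges and no vertex that is a sink or a source (so each vertex has either one incoming and two outgoing half-edges, or two incoming and one outgoing). Multiple edges, loops, and vertex-free components (oriented circles, each counted as one edge) are allowed. $V(\Gamma)$ and $E(\Gamma)$ are the sets of vertices and edges. A coloring (flow) is a map $\gamma:E(\Gamma)\to\mathbb N=\{0,1,2,\dots\}$ such that at each vertex the sum of the values on the incoming edges equals the sum of the values on the outgoing edges. **Half-edges at a vertex.** At a vertex $v$, let $(v,m)$ be the half-edge that is alone in its direction (the unique incoming or the unique outgoing one), and let $(v,l)$, $(v,r)$ be the other two half-edges, lying respectively on the left and on the right when facing in the direction of the orientation. **Cycles.** A cycle of $\Gamma$ is a (possibly empty, possibly disconnected) $2$-regular subgraph each of whose components is consistently oriented. $\mathcal C(\Gamma)$ is the set of cycles. The rotation number of a connected cycle is $\mathrm{rot}(C)=1$ if it is oriented counter-clockwise and $-1$ if clockwise; in general $\mathrm{rot}(C)$ is the sum over the connected components of $C$ (so $\mathrm{rot}(\emptyset)=0$). **States.** Let $A_N=\{-\frac{N-1}{2},-\frac{N-3}{2},\dots,\frac{N-3}{2},\frac{N-1}{2}\}$ (an $N$-element set). A state is a function $\sigma:\mathcal C(\Gamma)\to 2^{A_N}$ with $\sigma(\emptyset)=\emptyset$ and $\sigma(C)\cap\sigma(C')=\emptyset$ for all distinct cycles $C\ne C'$. For an edge $e$ or half-edge $h$ put $\sigma(e)=\bigcup_{C\ni e}\sigma(C)$, $\sigma(h)=\bigcup_{C\ni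 h}\sigma(C)$. Let $|\sigma|$ be the flow $|\sigma|(e)=|\sigma(e)|$, and $\mathrm{rot}(\sigma)=\sum_{C}\mathrm{rot}(C)\sum_{x\in\sigma(C)}x$. **MOY evaluation.** For a positive integer $N$ and a coloring $\gamma$, $$\langle\Gamma,\gamma\rangle_N(q)=\sum_{\sigma:\,|\sigma|=\gamma}q^{\mathrm{rot}(\sigma)}\prod_{v\in V(\Gamma)}\mathrm{wt}(v;\sigma),\qquad \mathrm{wt}(v;\sigma)=q^{\frac14(R(v;\sigma)-L(v;\sigma))},$$ where $L(v;\sigma)=|\{(a,b)\in\sigma(v,l)\times\sigma(v,r): a>b\}|$ and $R(v;\sigma)=|\{(a,b)\in\sigma(v,l)\times\sigma(v,r): a<b\}|$. *)

theory Defs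
  imports
    "HOL-Complex_Analysis.Complex_Analysis"
    "HOL-Library.Poly_Mapping"
    "HOL-Library.FuncSet"
begin

section \<open>MOY graphs\<close>

text \<open>A directed multigraph drawn in the plane: vertices are points, and the edge \<open>e\<close>,
  oriented by its parametrization, is drawn along \<open>curve \<Gamma> e\<close>.\<close>

record 'e plane_graph =
  verts :: "complex set"
  edges :: "'e set"
  curve :: "'e \<Rightarrow> real \<Rightarrow> complex"

abbreviation supp :: "('e, 'm) plane_graph_scheme \<Rightarrow> 'e \<Rightarrow> complex set" where
  "supp \<Gamma> e \<equiv> path_image (curve \<Gamma> e)"

text \<open>Vertex-free components.\<close>

definition is_circle :: "('e, 'm) plane_graph_scheme \<Rightarrow> 'e \<Rightarrow> bool" where
  "is_circle \<Gamma> e \<longleftrightarrow>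
     pathfinish (curve \<Gamma> e) = pathstart (curve \<Gamma> e) \<and> supp \<Gamma> e \<inter> verts \<Gamma> = {}"

definition in_edges :: "('e, 'm) plane_graph_scheme \<Rightarrow> complex \<Rightarrow> 'e set" where
  "in_edges \<Gamma> v = {e \<in> edges \<Gamma>. pathfinish (curve \<Gamma> e) = v}"

definition out_edges :: "('e, 'm) plane_graph_scheme \<Rightarrow> complex \<Rightarrow> 'e set" where
  "out_edges \<Gamma> v = {e \<in> edges \<Gamma>. pathstart (curve \<Gamma> e) = v}"

text \<open>A loop at \<open>v\<close> is counted once in \<open>in_edges \<Gamma> v\<close> and once in \<open>out_edges \<Gamma> v\<close>, so the last
  clause says that \<open>v\<close> is trivalent and neither a sink nor a source.
  Note that \<^const>\<open>simple_path\<close> allows the two endpoints to coincide.\<close>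

definition MOY_graph :: "('e, 'm) plane_graph_scheme \<Rightarrow> bool" where
  "MOY_graph \<Gamma> \<longleftrightarrow>
     finite (verts \<Gamma>) \<and> finite (edges \<Gamma>) \<and>
     (\<forall>e\<in>edges \<Gamma>. simple_path (curve \<Gamma> e)) \<and>
     (\<forall>e\<in>edges \<Gamma>. is_circle \<Gamma> e \<or>
        (pathstart (curve \<Gamma> e) \<in> verts \<Gamma> \<and> pathfinish (curve \<Gamma> e) \<in> verts \<Gamma> \<and>
         curve \<Gamma> e ` {0<..<1} \<inter> verts \<Gamma> = {})) \<and>
     (\<forall>e\<in>edges \<Gamma>. \<forall>e'\<in>edges \<Gamma>. e \<noteq> e' \<longrightarrow> supp \<Gamma> e \<inter> supp \<Gamma> e' \<subseteq> verts \<Gamma>) \<and>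
     (\<forall>v\<in>verts \<Gamma>.
        card (in_edges \<Gamma> v) = 1 \<and> card (out_edges \<Gamma> v) = 2 \<or>
        card (in_edges \<Gamma> v) = 2 \<and> card (out_edges \<Gamma> v) = 1)"

definition is_flow :: "('e, 'm) plane_graph_scheme \<Rightarrow> ('e \<Rightarrow> nat) \<Rightarrow> bool" where
  "is_flow \<Gamma> \<gamma> \<longleftrightarrow>
     (\<forall>v\<in>verts \<Gamma>. (\<Sum>e\<in>in_edges \<Gamma> v. \<gamma> e) = (\<Sum>e\<in>out_edges \<Gamma> v. \<gamma> e))"

definition colorings :: "('e, 'm) plane_graph_scheme \<Rightarrow> ('e \<Rightarrow> nat) set" where
  "colorings \<Gamma> = {\<gamma> \<in> edges \<Gamma> \<rightarrow>\<^sub>E UNIV. is_flow \<Gamma> \<gamma>}"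


section \<open>Half-edges, left and right\<close>

datatype 'e half_edge = Initial (edge_under: 'e) | Terminal (edge_under: 'e)

text \<open>\<open>Initial e\<close> is the half-edge going out of the tail of \<open>e\<close>, and \<open>Terminal e\<close> the half-edge
  coming into its head.\<close>

definition half_edges_at :: "('e, 'm) plane_graph_scheme \<Rightarrow> complex \<Rightarrow> 'e half_edge set" where
  "half_edges_at \<Gamma> v = Initial ` out_edges \<Gamma> v \<union> Terminal ` in_edges \<Gamma> v"

text \<open>The edge traversed starting at the vertex to which the half-edge is attached.\<close>

fun ray :: "('e, 'm) plane_graph_scheme \<Rightarrow> 'e half_edge \<Rightarrow> real \<Rightarrow> complex" where
  "ray \<Gamma> (Initial e) = curve \<Gamma> e"
| "ray \<Gamma> (Terminal e) = reversepath (curve \<Gamma> e)"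

text \<open>The first point of \<open>p\<close> at distance \<open>r\<close> from its starting point.\<close>

definition first_hit :: "(real \<Rightarrow> complex) \<Rightarrow> real \<Rightarrow> complex" where
  "first_hit p r = p (Inf {t \<in> {0..1}. dist (pathstart p) (p t) = r})"

text \<open>The counter-clockwise cyclic order of three curves leaving a common point and
  otherwise disjoint near it: it is read off from the first points where they meet a small circle
  around that point. Three points \<open>a, b, c\<close> of a circle are in counter-clockwise order iff the
  triangle \<open>a b c\<close> has positive signed area. By planarity the order does not
  depend on the radius once this is small enough. No tangent directions are needed, so edges may
  also be mutually tangent at a vertex.\<close>

definition ccw_rays :: "(real \<Rightarrow> complex) \<Rightarrow> (real \<Rightarrow> complex) \<Rightarrow> (real \<Rightarrow> complex) \<Rightarrow> bool" where
  "ccw_rays p1 p2 p3 \<longleftrightarrow>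
     (\<forall>\<^sub>F r in at_right 0.
        Im (cnj (first_hit p2 r - first_hit p1 r) * (first_hit p3 r - first_hit p1 r)) > 0)"

text \<open>\<open>m\<close> is the half-edge alone in its direction, \<open>l\<close> and \<open>r\<close> the left and right one of the other
  two. Facing in the direction of the orientation, an incoming \<open>m\<close> is behind and \<open>l, r\<close> are ahead,
  so the counter-clockwise order is \<open>m, r, l\<close>; an outgoing \<open>m\<close> is ahead and \<open>l, r\<close> are behind, so
  the counter-clockwise order is \<open>m, l, r\<close>.\<close>

definition mlr ::
  "('e, 'm) plane_graph_scheme \<Rightarrow> complex \<Rightarrow> 'e half_edge \<Rightarrow> 'e half_edge \<Rightarrow> 'e half_edge \<Rightarrow> bool"
where
  "mlr \<Gamma> v m l r \<longleftrightarrow>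
     half_edges_at \<Gamma> v = {m, l, r} \<and> distinct [m, l, r] \<and>
     ((\<not> is_Initial m \<and> is_Initial l \<and> is_Initial r \<and> ccw_rays (ray \<Gamma> m) (ray \<Gamma> r) (ray \<Gamma> l)) \<or>
      (is_Initial m \<and> \<not> is_Initial l \<and> \<not> is_Initial r \<and> ccw_rays (ray \<Gamma> m) (ray \<Gamma> l) (ray \<Gamma> r)))"

definition left_half :: "('e, 'm) plane_graph_scheme \<Rightarrow> complex \<Rightarrow> 'e half_edge" where
  "left_half \<Gamma> v = (THE l. \<exists>m r. mlr \<Gamma> v m l r)"

definition right_half :: "('e, 'm) plane_graph_scheme \<Rightarrow> complex \<Rightarrow> 'e half_edge" where
  "right_half \<Gamma> v = (THE r. \<exists>m l. mlr \<Gamma> v m l r)"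


section \<open>Cycles and rotation numbers\<close>

text \<open>A 2-regular subgraph has no isolated vertices, so it is given by its set of edges \<open>C\<close>. Its
  degree at \<open>v\<close> (loops counting twice) is 2 if \<open>v\<close> belongs to it and 0 otherwise. Its components
  are consistently oriented iff at each of its vertices one half-edge comes in and one goes out.
  Oriented circles impose no condition.\<close>

definition cycles :: "('e, 'm) plane_graph_scheme \<Rightarrow> 'e set set" where
  "cycles \<Gamma> = {C. C \<subseteq> edges \<Gamma> \<and>
     (\<forall>v\<in>verts \<Gamma>.
        card (C \<inter> in_edges \<Gamma> v) + card (C \<inter> out_edges \<Gamma> v) \<in> {0, 2} \<and>
        card (C \<inter> in_edges \<Gamma> v) = card (C \<inter> out_edges \<Gamma> v))}"

definition cycle_components :: "('e, 'm) plane_graph_scheme \<Rightarrow> 'e set \<Rightarrow> 'e set set" where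
  "cycle_components \<Gamma> C =
     (\<lambda>K. {e \<in> C. supp \<Gamma> e \<subseteq> K}) ` components (\<Union>e\<in>C. supp \<Gamma> e)"

text \<open>A connected cycle \<open>D\<close> is an oriented Jordan curve; it is counter-clockwise iff its winding
  number about the points it encloses is 1 (otherwise it is \<open>-1\<close>). Winding numbers of
  non-closed paths are additive under concatenation, so the sum below is the winding number of the
  closed curve traversing \<open>D\<close>, wherever the traversal starts.\<close>

definition counterclockwise :: "('e, 'm) plane_graph_scheme \<Rightarrow> 'e set \<Rightarrow> bool" where
  "counterclockwise \<Gamma> D \<longleftrightarrow>
     (\<forall>z \<in> inside (\<Union>e\<in>D. supp \<Gamma> e). (\<Sum>e\<in>D. winding_number (curve \<Gamma> e) z) = 1)"

definition rot :: "('e, 'm) plane_graph_scheme \<Rightarrow> 'e set \<Rightarrow> real" where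
  "rot \<Gamma> C = (\<Sum>D\<in>cycle_components \<Gamma> C. if counterclockwise \<Gamma> D then 1 else - 1)"


section \<open>States and the MOY evaluation\<close>

definition A_set :: "nat \<Rightarrow> real set" where
  "A_set N = (\<lambda>i. real i - (real N - 1) / 2) ` {..<N}"

definition states :: "('e, 'm) plane_graph_scheme \<Rightarrow> nat \<Rightarrow> ('e set \<Rightarrow> real set) set" where
  "states \<Gamma> N = {\<sigma> \<in> cycles \<Gamma> \<rightarrow>\<^sub>E Pow (A_set N).
     \<sigma> {} = {} \<and> (\<forall>C\<in>cycles \<Gamma>. \<forall>C'\<in>cycles \<Gamma>. C \<noteq> C' \<longrightarrow> \<sigma> C \<inter> \<sigma> C' = {})}"

definition on_edge ::
  "('e, 'm) plane_graph_scheme \<Rightarrow> ('e set \<Rightarrow> real set) \<Rightarrow> 'e \<Rightarrow> real set" where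
  "on_edge \<Gamma> \<sigma> e = (\<Union>C\<in>{C \<in> cycles \<Gamma>. e \<in> C}. \<sigma> C)"

text \<open>A cycle contains a half-edge iff it contains the edge it belongs to.\<close>

definition on_half ::
  "('e, 'm) plane_graph_scheme \<Rightarrow> ('e set \<Rightarrow> real set) \<Rightarrow> 'e half_edge \<Rightarrow> real set" where
  "on_half \<Gamma> \<sigma> h = on_edge \<Gamma> \<sigma> (edge_under h)"

definition state_flow ::
  "('e, 'm) plane_graph_scheme \<Rightarrow> ('e set \<Rightarrow> real set) \<Rightarrow> 'e \<Rightarrow> nat" where
  "state_flow \<Gamma> \<sigma> = (\<lambda>e\<in>edges \<Gamma>. card (on_edge \<Gamma> \<sigma> e))"

definition rot_state :: "('e, 'm) plane_graph_scheme \<Rightarrow> ('e set \<Rightarrow> real set) \<Rightarrow> real" where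
  "rot_state \<Gamma> \<sigma> = (\<Sum>C\<in>cycles \<Gamma>. rot \<Gamma> C * (\<Sum>x\<in>\<sigma> C. x))"

definition L_count ::
  "('e, 'm) plane_graph_scheme \<Rightarrow> ('e set \<Rightarrow> real set) \<Rightarrow> complex \<Rightarrow> nat" where
  "L_count \<Gamma> \<sigma> v = card {(a, b) \<in>
     on_half \<Gamma> \<sigma> (left_half \<Gamma> v) \<times> on_half \<Gamma> \<sigma> (right_half \<Gamma> v). a > b}"

definition R_count ::
  "('e, 'm) plane_graph_scheme \<Rightarrow> ('e set \<Rightarrow> real set) \<Rightarrow> complex \<Rightarrow> nat" where
  "R_count \<Gamma> \<sigma> v = card {(a, b) \<in>
     on_half \<Gamma> \<sigma> (left_half \<Gamma> v) \<times> on_half \<Gamma> \<sigma> (right_half \<Gamma> v). a < b}"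

text \<open>The fractional powers of \<open>q\<close> are read as powers of a positive real number \<open>q\<close>.\<close>

definition wt ::
  "('e, 'm) plane_graph_scheme \<Rightarrow> ('e set \<Rightarrow> real set) \<Rightarrow> real \<Rightarrow> complex \<Rightarrow> real" where
  "wt \<Gamma> \<sigma> q v = q powr ((real (R_count \<Gamma> \<sigma> v) - real (L_count \<Gamma> \<sigma> v)) / 4)"

definition MOY_eval ::
  "('e, 'm) plane_graph_scheme \<Rightarrow> nat \<Rightarrow> ('e \<Rightarrow> nat) \<Rightarrow> real \<Rightarrow> real" where
  "MOY_eval \<Gamma> N \<gamma> q =
     (\<Sum>\<sigma> | \<sigma> \<in> states \<Gamma> N \<and> state_flow \<Gamma> \<sigma> = \<gamma>.
        q powr rot_state \<Gamma> \<sigma> * (\<Prod>v\<in>verts \<Gamma>. wt \<Gamma> \<sigma> q v))"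


section \<open>The two polynomials\<close>

text \<open>Polynomials over the reals in commuting variables indexed by \<open>'e\<close>: a monomial is a finitely
  supported exponent function.\<close>

type_synonym 'e edge_poly = "('e \<Rightarrow>\<^sub>0 nat) \<Rightarrow>\<^sub>0 real"

definition w_var :: "'e \<Rightarrow> 'e edge_poly" where
  "w_var e = Poly_Mapping.single (Poly_Mapping.single e 1) 1"

definition const_poly :: "real \<Rightarrow> 'e edge_poly" where
  "const_poly c = Poly_Mapping.single 0 c"

text \<open>There are in general infinitely many colorings, but only finitely many have a
  nonzero evaluation, and \<open>F_class\<close> sums over those.\<close>

lemma finite_A_set: "finite (A_set N)"
  by (simp add: A_set_def)

lemma finite_nonzero_colorings:
  assumes "MOY_graph \<Gamma>"
  shows "finite {\<gamma> \<in> colorings \<Gamma>. MOY_eval \<Gamma> N \<gamma> q \<noteq> 0}"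
proof (rule finite_subset)
  show "{\<gamma> \<in> colorings \<Gamma>. MOY_eval \<Gamma> N \<gamma> q \<noteq> 0} \<subseteq> edges \<Gamma> \<rightarrow>\<^sub>E {..card (A_set N)}"
  proof
    fix \<gamma> assume "\<gamma> \<in> {\<gamma> \<in> colorings \<Gamma>. MOY_eval \<Gamma> N \<gamma> q \<noteq> 0}"
    hence ne: "MOY_eval \<Gamma> N \<gamma> q \<noteq> 0" by simp
    then obtain \<sigma> where \<sigma>: "\<sigma> \<in> states \<Gamma> N" "state_flow \<Gamma> \<sigma> = \<gamma>"
      unfolding MOY_eval_def by (metis (mono_tags, lifting) mem_Collect_eq sum.neutral)
    have "on_edge \<Gamma> \<sigma> e \<subseteq> A_set N" for e
      using \<sigma>(1) by (auto simp: on_edge_def states_def PiE_iff)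
    hence "card (on_edge \<Gamma> \<sigma> e) \<le> card (A_set N)" for e
      by (simp add: card_mono finite_A_set)
    thus "\<gamma> \<in> edges \<Gamma> \<rightarrow>\<^sub>E {..card (A_set N)}"
      using \<sigma>(2) by (auto simp: state_flow_def)
  qed
  show "finite (edges \<Gamma> \<rightarrow>\<^sub>E {..card (A_set N)})"
    using assms by (intro finite_PiE) (auto simp: MOY_graph_def)
qed

definition F_class :: "('e, 'm) plane_graph_scheme \<Rightarrow> nat \<Rightarrow> 'e edge_poly" where
  "F_class \<Gamma> N = (\<Sum>\<gamma> | \<gamma> \<in> colorings \<Gamma> \<and> MOY_eval \<Gamma> N \<gamma> 1 \<noteq> 0.
     const_poly (MOY_eval \<Gamma> N \<gamma> 1) * (\<Prod>e\<in>edges \<Gamma>. w_var e ^ \<gamma> e))"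

definition P_class :: "('e, 'm) plane_graph_scheme \<Rightarrow> 'e edge_poly" where
  "P_class \<Gamma> = (\<Sum>C\<in>cycles \<Gamma>. \<Prod>e\<in>C. w_var e)"

end

(* At q = 1 every state has weight 1. A state is the same thing as a function f from A_N to the
   cycles: f x is the unique C with x in sigma(C), and the empty cycle if there is none. Under this
   correspondence the monomial of the flow of sigma is the product over x in A_N of the monomials
   of the cycles f x, and expanding the N-th power of the cycle polynomial gives the sum over f. *)
theory Submission
  imports Defs
begin

lemma card_A_set [simp]: "card (A_set N) = N"
  unfolding A_set_def by (subst card_image) (auto simp: inj_on_def)

lemma empty_in_cycles [simp]: "{} \<in> cycles \<Gamma>"
  by (simp add: cycles_def)

lemma cycles_subset_edges: "C \<in> cycles \<Gamma> \<Longrightarrow> C \<subseteq> edges \<Gamma>"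
  by (simp add: cycles_def)

lemma finite_cycles: "finite (edges \<Gamma>) \<Longrightarrow> finite (cycles \<Gamma>)"
  by (rule finite_subset[of _ "Pow (edges \<Gamma>)"]) (auto simp: cycles_def)

lemma finite_states:
  assumes "finite (edges \<Gamma>)"
  shows "finite (states \<Gamma> N)"
  by (rule finite_subset[of _ "cycles \<Gamma> \<rightarrow>\<^sub>E Pow (A_set N)"])
    (auto simp: states_def finite_cycles[OF assms] finite_A_set intro!: finite_PiE)

lemma MOY_eval_at_1:
  "MOY_eval \<Gamma> N \<gamma> 1 = real (card {\<sigma> \<in> states \<Gamma> N. state_flow \<Gamma> \<sigma> = \<gamma>})"
  by (simp add: MOY_eval_def wt_def)

definition state_of ::
  "('e, 'm) plane_graph_scheme \<Rightarrow> nat \<Rightarrow> (real \<Rightarrow> 'e set) \<Rightarrow> 'e set \<Rightarrow> real set" where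
  "state_of \<Gamma> N f = (\<lambda>C\<in>cycles \<Gamma>. if C = {} then {} else {x \<in> A_set N. f x = C})"

definition cycle_at ::
  "('e, 'm) plane_graph_scheme \<Rightarrow> nat \<Rightarrow> ('e set \<Rightarrow> real set) \<Rightarrow> real \<Rightarrow> 'e set" where
  "cycle_at \<Gamma> N \<sigma> = (\<lambda>x\<in>A_set N. \<Union>{C \<in> cycles \<Gamma>. x \<in> \<sigma> C})"

lemma state_of_in_states: "state_of \<Gamma> N f \<in> states \<Gamma> N"
  by (auto simp: states_def state_of_def)

text \<open>Disjointness of the values of a state leaves \<open>C\<close> as the only cycle carrying
  \<open>x\<close>.\<close>

lemma cycle_at_eq:
  assumes "\<sigma> \<in> states \<Gamma> N" "C \<in> cycles \<Gamma>" "x \<in> \<sigma> C"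
  shows "cycle_at \<Gamma> N \<sigma> x = C"
proof -
  have "\<forall>C'\<in>cycles \<Gamma>. C' \<noteq> C \<longrightarrow> \<sigma> C' \<inter> \<sigma> C = {}"
    using assms(1,2) by (simp add: states_def)
  then have "{C' \<in> cycles \<Gamma>. x \<in> \<sigma> C'} = {C}"
    using assms(2,3) by blast
  moreover have "x \<in> A_set N"
    using assms by (auto simp: states_def PiE_iff)
  ultimately show ?thesis
    by (simp add: cycle_at_def)
qed

lemma cycle_at_in_cycles:
  assumes "\<sigma> \<in> states \<Gamma> N"
  shows "cycle_at \<Gamma> N \<sigma> \<in> A_set N \<rightarrow>\<^sub>E cycles \<Gamma>"
proof
  fix x assume x: "x \<in> A_set N"
  show "cycle_at \<Gamma> N \<sigma> x \<in> cycles \<Gamma>"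
  proof (cases "\<exists>C\<in>cycles \<Gamma>. x \<in> \<sigma> C")
    case True
    then show ?thesis using cycle_at_eq[OF assms] by metis
  next
    case False
    then have "{C \<in> cycles \<Gamma>. x \<in> \<sigma> C} = {}" by blast
    with x show ?thesis by (simp only: cycle_at_def restrict_apply') simp
  qed
qed (simp add: cycle_at_def)

lemma cycle_at_state_of:
  assumes "f \<in> A_set N \<rightarrow>\<^sub>E cycles \<Gamma>"
  shows "cycle_at \<Gamma> N (state_of \<Gamma> N f) = f"
proof
  fix x
  show "cycle_at \<Gamma> N (state_of \<Gamma> N f) x = f x"
  proof (cases "x \<in> A_set N")
    case True
    then have "f x \<in> cycles \<Gamma>" using assms by auto
    \<comment> \<open>Both cases have union \<open>f x\<close>: a label sent to the empty cycle is
      recovered from the empty union.\<close>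
    with True have "{C \<in> cycles \<Gamma>. x \<in> state_of \<Gamma> N f C} = (if f x = {} then {} else {f x})"
      by (auto simp: state_of_def)
    with True show ?thesis by (simp add: cycle_at_def)
  next
    case False
    then show ?thesis using assms by (auto simp: cycle_at_def)
  qed
qed

lemma state_of_cycle_at:
  assumes "\<sigma> \<in> states \<Gamma> N"
  shows "state_of \<Gamma> N (cycle_at \<Gamma> N \<sigma>) = \<sigma>"
proof
  fix C
  consider "C \<notin> cycles \<Gamma>" | "C = {}" | "C \<in> cycles \<Gamma>" "C \<noteq> {}" by blast
  then show "state_of \<Gamma> N (cycle_at \<Gamma> N \<sigma>) C = \<sigma> C"
  proof cases
    case 3
    have "x \<in> \<sigma> C" if x: "x \<in> A_set N" "cycle_at \<Gamma> N \<sigma> x = C" for x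
    proof -
      \<comment> \<open>Since \<open>C\<close> is nonempty, it is not the default value, so some
        cycle really carries \<open>x\<close>; by \<open>cycle_at_eq\<close> that cycle is
        \<open>C\<close>.\<close>
      from x \<open>C \<noteq> {}\<close> obtain C' where "C' \<in> cycles \<Gamma>" "x \<in> \<sigma> C'"
        by (auto simp: cycle_at_def)
      with x cycle_at_eq[OF assms] show ?thesis by metis
    qed
    moreover have "x \<in> A_set N \<and> cycle_at \<Gamma> N \<sigma> x = C" if "x \<in> \<sigma> C" for x
      using that 3 assms cycle_at_eq[OF assms 3(1)] by (auto simp: states_def PiE_iff)
    ultimately show ?thesis
      using 3 by (auto simp: state_of_def)
  \<comment> \<open>Outside \<open>cycles \<Gamma>\<close> both sides are \<open>undefined\<close>;
    at \<open>{}\<close> both are empty.\<close>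
  qed (use assms in \<open>auto simp: state_of_def states_def\<close>)
qed

lemma bij_betw_state_of: "bij_betw (state_of \<Gamma> N) (A_set N \<rightarrow>\<^sub>E cycles \<Gamma>) (states \<Gamma> N)"
proof (rule bij_betw_byWitness[where f' = "cycle_at \<Gamma> N"])
  show "state_of \<Gamma> N ` (A_set N \<rightarrow>\<^sub>E cycles \<Gamma>) \<subseteq> states \<Gamma> N"
    by (rule image_subsetI) (rule state_of_in_states)
  show "cycle_at \<Gamma> N ` states \<Gamma> N \<subseteq> A_set N \<rightarrow>\<^sub>E cycles \<Gamma>"
    by (rule image_subsetI) (rule cycle_at_in_cycles)
qed (simp_all add: cycle_at_state_of state_of_cycle_at)

text \<open>A cycle through \<open>e\<close> is nonempty, so the special clause of
  \<open>state_of\<close> at \<open>{}\<close> never applies here.\<close>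

lemma on_edge_state_of:
  assumes "f \<in> A_set N \<rightarrow>\<^sub>E cycles \<Gamma>"
  shows "on_edge \<Gamma> (state_of \<Gamma> N f) e = {x \<in> A_set N. e \<in> f x}"
  using assms by (auto simp: on_edge_def state_of_def split: if_splits)

lemma state_flow_state_of:
  assumes "f \<in> A_set N \<rightarrow>\<^sub>E cycles \<Gamma>" "e \<in> edges \<Gamma>"
  shows "state_flow \<Gamma> (state_of \<Gamma> N f) e = card {x \<in> A_set N. e \<in> f x}"
  using assms by (simp add: state_flow_def on_edge_state_of)

text \<open>Double counting of the pairs \<open>(e, x)\<close> with
  \<open>e \<in> f x\<close>.\<close>

lemma sum_card_incidence:
  assumes "finite A" "finite B"
  shows "(\<Sum>e\<in>B. card {x \<in> A. e \<in> f x}) = (\<Sum>x\<in>A. card (f x \<inter> B))"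
proof -
  have "(\<Sum>e\<in>B. card {x \<in> A. e \<in> f x}) = (\<Sum>x\<in>A. card {e \<in> B. e \<in> f x})"
    using assms by (intro sum_multicount_gen) auto
  then show ?thesis by (simp add: Int_def conj_commute)
qed

text \<open>The indicator function of a cycle is a flow, and the flow of a state is the sum of these
  indicators over all labels. This ensures that a sum over colorings misses no state.\<close>

lemma state_flow_in_colorings:
  assumes "finite (edges \<Gamma>)" "\<sigma> \<in> states \<Gamma> N"
  shows "state_flow \<Gamma> \<sigma> \<in> colorings \<Gamma>"
proof -
  obtain f where f: "f \<in> A_set N \<rightarrow>\<^sub>E cycles \<Gamma>" and \<sigma>: "\<sigma> = state_of \<Gamma> N f"
    using assms(2) state_of_cycle_at cycle_at_in_cycles by metis
  \<comment> \<open>Stated for a general \<open>B\<close> so that it covers both the incoming and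
    the outgoing edges at a vertex.\<close>
  have count: "(\<Sum>e\<in>B. state_flow \<Gamma> \<sigma> e) = (\<Sum>x\<in>A_set N. card (f x \<inter> B))"
    if "B \<subseteq> edges \<Gamma>" for B
  proof -
    have "(\<Sum>e\<in>B. state_flow \<Gamma> \<sigma> e) = (\<Sum>e\<in>B. card {x \<in> A_set N. e \<in> f x})"
      using that by (intro sum.cong) (auto simp: \<sigma> state_flow_state_of[OF f])
    also have "\<dots> = (\<Sum>x\<in>A_set N. card (f x \<inter> B))"
      using that assms(1) by (intro sum_card_incidence finite_A_set) (rule finite_subset)
    finally show ?thesis .
  qed
  have "is_flow \<Gamma> (state_flow \<Gamma> \<sigma>)"
    unfolding is_flow_def
  proof
    fix v assume v: "v \<in> verts \<Gamma>"
    have "card (f x \<inter> in_edges \<Gamma> v) = card (f x \<inter> out_edges \<Gamma> v)" if "x \<in> A_set N" for x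
      using PiE_mem[OF f that] v by (simp add: cycles_def)
    moreover have "in_edges \<Gamma> v \<subseteq> edges \<Gamma>" "out_edges \<Gamma> v \<subseteq> edges \<Gamma>"
      by (auto simp: in_edges_def out_edges_def)
    ultimately show "sum (state_flow \<Gamma> \<sigma>) (in_edges \<Gamma> v) = sum (state_flow \<Gamma> \<sigma>) (out_edges \<Gamma> v)"
      by (simp add: count)
  qed
  then show ?thesis
    by (simp add: colorings_def state_flow_def)
qed

text \<open>The multiplicative double count: each power is a product over \<open>A\<close> with
  factors \<open>w e\<close> or 1, and the two products are swapped.\<close>

lemma prod_power_card_incidence:
  fixes w :: "'e \<Rightarrow> 'a::comm_semiring_1"
  assumes "finite A" "finite E" "\<And>x. x \<in> A \<Longrightarrow> f x \<subseteq> E"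
  shows "(\<Prod>e\<in>E. w e ^ card {x \<in> A. e \<in> f x}) = (\<Prod>x\<in>A. \<Prod>e\<in>f x. w e)"
proof -
  have "(\<Prod>e\<in>E. w e ^ card {x \<in> A. e \<in> f x}) = (\<Prod>e\<in>E. \<Prod>x\<in>A. if e \<in> f x then w e else 1)"
    using assms(1) by (simp flip: prod.inter_filter)
  also have "\<dots> = (\<Prod>x\<in>A. \<Prod>e\<in>E. if e \<in> f x then w e else 1)"
    by (rule prod.swap)
  also have "\<dots> = (\<Prod>x\<in>A. \<Prod>e\<in>f x. w e)"
  proof (rule prod.cong[OF refl])
    fix x assume "x \<in> A"
    then have "{e \<in> E. e \<in> f x} = f x" using assms(3) by blast
    then show "(\<Prod>e\<in>E. if e \<in> f x then w e else 1) = (\<Prod>e\<in>f x. w e)"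
      using assms(2) by (simp flip: prod.inter_filter)
  qed
  finally show ?thesis .
qed

lemma const_poly_of_nat: "const_poly (real n) = of_nat n"
  by (simp add: const_poly_def flip: single_of_nat)

lemma F_class_eq_sum_states:
  assumes "MOY_graph \<Gamma>"
  shows "F_class \<Gamma> N = (\<Sum>\<sigma>\<in>states \<Gamma> N. \<Prod>e\<in>edges \<Gamma>. w_var e ^ state_flow \<Gamma> \<sigma> e)"
proof -
  have fin: "finite (edges \<Gamma>)" using assms by (simp add: MOY_graph_def)
  let ?T = "{\<gamma> \<in> colorings \<Gamma>. MOY_eval \<Gamma> N \<gamma> 1 \<noteq> 0}"
  have "F_class \<Gamma> N = (\<Sum>\<gamma>\<in>?T. \<Sum>\<sigma> | \<sigma> \<in> states \<Gamma> N \<and> state_flow \<Gamma> \<sigma> = \<gamma>.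
      \<Prod>e\<in>edges \<Gamma>. w_var e ^ state_flow \<Gamma> \<sigma> e)"
    \<comment> \<open>The monomial is constant on the states with flow \<gamma>, and the coefficient
      is their number.\<close>
    unfolding F_class_def by (rule sum.cong) (auto simp: MOY_eval_at_1 const_poly_of_nat)
  also have "\<dots> = (\<Sum>\<sigma>\<in>states \<Gamma> N. \<Prod>e\<in>edges \<Gamma>. w_var e ^ state_flow \<Gamma> \<sigma> e)"
  proof (rule sum.group)
    \<comment> \<open>A coloring that is the flow of some state has a nonempty set of such states,
      so its evaluation at 1 is nonzero.\<close>
    show "state_flow \<Gamma> ` states \<Gamma> N \<subseteq> ?T"
      using finite_states[OF fin] state_flow_in_colorings[OF fin] by (auto simp: MOY_eval_at_1)
  qed (use assms finite_nonzero_colorings finite_states[OF fin] in auto)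
  finally show ?thesis .
qed

theorem theorem1p1:
  fixes \<Gamma> :: "'e plane_graph" and N :: nat
  assumes "MOY_graph \<Gamma>" and "N > 0"
  shows "F_class \<Gamma> N = P_class \<Gamma> ^ N"
proof -
  have fin: "finite (edges \<Gamma>)" using assms(1) by (simp add: MOY_graph_def)
  have "F_class \<Gamma> N = (\<Sum>\<sigma>\<in>states \<Gamma> N. \<Prod>e\<in>edges \<Gamma>. w_var e ^ state_flow \<Gamma> \<sigma> e)"
    using assms(1) by (rule F_class_eq_sum_states)
  also have "\<dots> = (\<Sum>f\<in>A_set N \<rightarrow>\<^sub>E cycles \<Gamma>.
      \<Prod>e\<in>edges \<Gamma>. w_var e ^ state_flow \<Gamma> (state_of \<Gamma> N f) e)"
    by (rule sum.reindex_bij_betw[OF bij_betw_state_of, symmetric])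
  also have "\<dots> = (\<Sum>f\<in>A_set N \<rightarrow>\<^sub>E cycles \<Gamma>. \<Prod>x\<in>A_set N. \<Prod>e\<in>f x. w_var e)"
  proof (rule sum.cong[OF refl])
    fix f assume f: "f \<in> A_set N \<rightarrow>\<^sub>E cycles \<Gamma>"
    then have "f x \<subseteq> edges \<Gamma>" if "x \<in> A_set N" for x
      using that by (intro cycles_subset_edges) auto
    from prod_power_card_incidence[OF finite_A_set fin this]
    show "(\<Prod>e\<in>edges \<Gamma>. w_var e ^ state_flow \<Gamma> (state_of \<Gamma> N f) e) =
        (\<Prod>x\<in>A_set N. \<Prod>e\<in>f x. w_var e)"
      by (simp add: state_flow_state_of[OF f])
  qed
  \<comment> \<open>Distributivity: expanding a product of sums means choosing one cycle for every
    label, that is, a function \<open>f\<close>.\<close>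
  also have "\<dots> = (\<Prod>x\<in>A_set N. \<Sum>C\<in>cycles \<Gamma>. \<Prod>e\<in>C. w_var e)"
    by (rule prod_sum_PiE[symmetric]) (simp_all add: finite_A_set finite_cycles[OF fin])
  \<comment> \<open>The factor is the same for every label, and \<open>card_A_set\<close> gives the
    exponent.\<close>
  also have "\<dots> = P_class \<Gamma> ^ N"
    by (simp add: P_class_def)
  finally show ?thesis .
qed

end
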